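(* Let $\psi : \mathbb{N} \to \mathbb{R}$ satisfy $\lim_{\Omega(n)\to\infty}\psi(n) = +\infty$, i.e. for every $M$ there is $K$ such that $\psi(n) > M$ whenever $\Omega(n) \ge K$. Then there exists a primitive set $A \subseteq \{2,3,\ldots\}$ such that (I) for every $0 < z < 2$, $\sum_{a \in A} \frac{\psi(a)\, z^{\Omega(a)}}{a(\log a)^z} = \infty$; and (II) $f_z(A) = \infty$ for every $z \ge 2$.
   Context: A set $A \subseteq \mathbb{N}$ is primitive if for $a_1, a_2 \in A$, $a_1 \mid a_2$ implies $a_1 = a_2$. $\Omega(n)$ is the number of prime factors of $n$ counted with multiplicity. $f_z(A) = \sum_{a \in A} \frac{z^{\Omega(a)}}{a(\log a)^z}$. *)

theory Defs
  imports "HOL-Analysis.Analysis" "HOL-Computational_Algebra.Primes"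
begin

definition Omega :: "nat \<Rightarrow> nat" where
  "Omega n = size (prime_factorization n)"

definition primitive_set :: "nat set \<Rightarrow> bool" where
  "primitive_set A \<longleftrightarrow> (\<forall>a1\<in>A. \<forall>a2\<in>A. a1 dvd a2 \<longrightarrow> a1 = a2)"

text \<open>
  Sums over sets of naturals are taken as unordered sums of extended reals, so that
  divergence to infinity is an ordinary value: an \<^const>\<open>infsum\<close> of finite terms is
  \<open>\<infinity>\<close> iff the net of finite partial sums tends to \<open>\<infinity>\<close>. (The default value of
  \<^const>\<open>infsum\<close> for a sum that does not exist is 0, hence never \<open>\<infinity>\<close>.) For
  nonnegative terms, in particular for \<open>f_sum z A\<close> with \<open>z \<ge> 0\<close>
  and \<open>A \<subseteq> {2..}\<close>, the sum always exists.
\<close>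

definition f_sum :: "real \<Rightarrow> nat set \<Rightarrow> ereal" where
  "f_sum z A = (\<Sum>\<^sub>\<infinity>a\<in>A. ereal (z ^ Omega a / (real a * ln (real a) powr z)))"

end

theory Submission
  imports Defs "HOL-Probability.Distributions"
begin

text \<open>
  For each odd prime \<open>q\<close> take the block of all \<open>q m\<close> where \<open>\<Omega>(m) = k(q)\<close> and every prime factor
  of \<open>m\<close> is \<open>2\<close> or exceeds \<open>q\<close>. If \<open>k\<close> is strictly increasing, the union of the blocks is
  primitive, however fast \<open>k\<close> grows; so it suffices that the block of \<open>q\<close> contributes to \<open>f\<^sub>z\<close> at
  least an amount depending on \<open>q\<close> and \<open>z\<close> only (this is then compensated by \<open>\<psi>\<close>), and \<open>k(q) div 2\<close>
  times that amount when \<open>z \<ge> 2\<close>.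

  The bound uniform in \<open>k\<close> comes from writing \<open>(log m)\<^sup>-\<^sup>z\<close>, up to a constant, as the integral of
  \<open>exp (- z u) m powr (- exp (- u))\<close> over all real \<open>u\<close>. Summing over the \<open>m\<close> with \<open>\<Omega>(m) = l\<close> whose prime
  factors exceed \<open>q\<close> gives at least the integral of \<open>exp (- z u) P(u)\<^sup>l / l!\<close>, where \<open>P(u)\<close> is the sum of
  \<open>p powr (- 1 - exp (- u))\<close> over the primes \<open>p > q\<close>. The Euler product yields \<open>P(u) \<ge> u - c\<close>, and
  the resulting Gamma integral is \<open>exp (- c z) / z\<^sup>l\<^sup>+\<^sup>1\<close>. For \<open>z \<ge> 2\<close> the numbers \<open>2\<^sup>j m\<close> with
  \<open>\<Omega>(m) = k(q) - j\<close> contribute comparable amounts for all \<open>j < k(q) div 2\<close>, because \<open>2\<^sup>j \<le> m\<close>.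
\<close>

subsection \<open>Sums over almost primes\<close>

lemma Omega_mult: "a \<noteq> 0 \<Longrightarrow> b \<noteq> 0 \<Longrightarrow> Omega (a * b) = Omega a + Omega b"
  by (simp add: Omega_def prime_factorization_mult)

lemma Omega_prime: "prime p \<Longrightarrow> Omega p = 1"
  by (simp add: Omega_def prime_factorization_prime)

lemma Omega_power: "a \<noteq> 0 \<Longrightarrow> Omega (a ^ k) = k * Omega a"
  by (induction k) (simp_all add: Omega_mult, simp add: Omega_def)

lemma prod_mset_bounds:
  fixes M :: "nat multiset"
  assumes "\<And>x. x \<in># M \<Longrightarrow> 2 \<le> x \<and> x \<le> N"
  shows "2 ^ size M \<le> prod_mset M" "prod_mset M \<le> N ^ size M"
  using assms by (induction M) (auto intro!: mult_mono)

lemma Omega_bounds: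
  assumes "n > 0"
  shows "2 ^ Omega n \<le> n"
    and "(\<And>p. prime p \<Longrightarrow> p dvd n \<Longrightarrow> p \<le> N) \<Longrightarrow> n \<le> N ^ Omega n"
proof -
  have n: "prod_mset (prime_factorization n) = n"
    using assms by (simp add: prod_mset_prime_factorization_nat)
  show "2 ^ Omega n \<le> n"
    using prod_mset_bounds(1)[of "prime_factorization n" n] assms n
    by (auto simp: Omega_def in_prime_factors_iff prime_ge_2_nat dvd_imp_le)
  show "n \<le> N ^ Omega n" if "\<And>p. prime p \<Longrightarrow> p dvd n \<Longrightarrow> p \<le> N"
    using prod_mset_bounds(2)[of "prime_factorization n" N] that n
    by (auto simp: Omega_def in_prime_factors_iff prime_ge_2_nat)
qed

text \<open>The condition \<open>n > 0\<close> matters: \<open>0\<close> has empty prime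
  factorization and would otherwise belong to \<open>almost_primes S 0\<close>.\<close>

definition almost_primes :: "nat set \<Rightarrow> nat \<Rightarrow> nat set" where
  "almost_primes S k = {n. n > 0 \<and> Omega n = k \<and> prime_factors n \<subseteq> S}"

lemma finite_almost_primes:
  assumes "finite S"
  shows "finite (almost_primes S k)"
proof (rule finite_subset)
  show "almost_primes S k \<subseteq> {..Max (insert 0 S) ^ k}"
    using assms by (auto simp: almost_primes_def in_prime_factors_iff intro!: Omega_bounds(2) Max_ge)
qed simp

text \<open>Each of the \<open>n\<close> on the right arises from at most \<open>k!\<close> ordered \<open>k\<close>-tuples of primes.\<close>

lemma power_sum_le_almost_primes:
  fixes \<sigma> :: real
  assumes "finite S" "\<And>p. p \<in> S \<Longrightarrow> prime p"
  shows "(\<Sum>p\<in>S. real p powr \<sigma>) ^ k \<le> fact k * (\<Sum>n\<in>almost_primes S k. real n powr \<sigma>)"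
proof (induction k)
  case 0
  have "1 \<in> almost_primes S 0"
    by (simp add: almost_primes_def Omega_def)
  then have "(\<Sum>n\<in>{1}. real n powr \<sigma>) \<le> (\<Sum>n\<in>almost_primes S 0. real n powr \<sigma>)"
    using finite_almost_primes[OF assms(1), of 0] by (intro sum_mono2) auto
  then show ?case by simp
next
  case (Suc k)
  let ?f = "\<lambda>n. real n powr \<sigma>"
  let ?A = "almost_primes S k" and ?B = "almost_primes S (Suc k)"
  note fin = finite_almost_primes[OF assms(1)]
  have pos: "p > 0" if "p \<in> S" for p
    using assms(2)[OF that] by (simp add: prime_gt_0_nat)
  \<comment> \<open>After multiplication by one more prime, each \<open>n\<close> in
    \<open>?B\<close> arises once for each of its distinct prime divisors in \<open>S\<close>, hence
    at most \<open>Suc k\<close> times; this factor turns \<open>fact k\<close> into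
    \<open>fact (Suc k)\<close>.\<close>
  have "(\<Sum>p\<in>S. ?f p) * (\<Sum>n\<in>?A. ?f n) = (\<Sum>p\<in>S. \<Sum>n\<in>?A. ?f (p * n))"
    by (simp add: sum_product powr_mult)
  also have "\<dots> = (\<Sum>p\<in>S. \<Sum>n\<in>(*) p ` ?A. ?f n)"
  proof (rule sum.cong[OF refl])
    fix p assume "p \<in> S"
    then have "inj_on ((*) p) ?A"
      using pos by (auto simp: inj_on_def)
    then show "(\<Sum>n\<in>?A. ?f (p * n)) = (\<Sum>n\<in>(*) p ` ?A. ?f n)"
      by (simp add: sum.reindex)
  qed
  also have "\<dots> \<le> (\<Sum>p\<in>S. \<Sum>n | n \<in> ?B \<and> p dvd n. ?f n)"
  proof (intro sum_mono sum_mono2)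
    fix p assume p: "p \<in> S"
    show "(*) p ` ?A \<subseteq> {n \<in> ?B. p dvd n}"
      using p pos[OF p] assms(2)[OF p]
      by (auto simp: almost_primes_def Omega_mult Omega_prime prime_factors_product
            prime_prime_factors)
  qed (use fin in auto)
  also have "\<dots> = (\<Sum>n\<in>?B. \<Sum>p | p \<in> S \<and> p dvd n. ?f n)"
    using assms(1) fin by (intro sum.swap_restrict)
  also have "\<dots> \<le> (\<Sum>n\<in>?B. real (Suc k) * ?f n)"
  proof (intro sum_mono)
    fix n assume n: "n \<in> ?B"
    have "card {p \<in> S. p dvd n} \<le> card (prime_factors n)"
      using n assms(2) by (intro card_mono) (auto simp: almost_primes_def in_prime_factors_iff)
    also have "\<dots> = size (mset_set (prime_factors n))"
      by simp
    also have "\<dots> \<le> size (prime_factorization n)"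
      by (intro size_mset_mono mset_set_set_mset_msubset)
    also have "\<dots> = Suc k"
      using n by (simp add: almost_primes_def Omega_def)
    finally have "real (card {p \<in> S. p dvd n}) \<le> real (Suc k)"
      by linarith
    then show "(\<Sum>p | p \<in> S \<and> p dvd n. ?f n) \<le> real (Suc k) * ?f n"
      by (simp add: mult_right_mono del: of_nat_Suc)
  qed
  also have "\<dots> = real (Suc k) * (\<Sum>n\<in>?B. ?f n)"
    by (simp add: sum_distrib_left)
  finally have *: "(\<Sum>p\<in>S. ?f p) * (\<Sum>n\<in>?A. ?f n) \<le> real (Suc k) * (\<Sum>n\<in>?B. ?f n)" .
  have "(\<Sum>p\<in>S. ?f p) ^ Suc k \<le> (\<Sum>p\<in>S. ?f p) * (fact k * (\<Sum>n\<in>?A. ?f n))"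
    using Suc by (auto intro!: mult_left_mono sum_nonneg)
  also have "\<dots> = fact k * ((\<Sum>p\<in>S. ?f p) * (\<Sum>n\<in>?A. ?f n))"
    by simp
  also have "\<dots> \<le> fact k * (real (Suc k) * (\<Sum>n\<in>?B. ?f n))"
    using * by (intro mult_left_mono) auto
  finally show ?case
    by (simp add: mult.assoc mult.left_commute mult.commute)
qed

subsection \<open>A lower bound for the prime zeta function\<close>

text \<open>One half of the Euler product, with \<open>n\<close> cut off at \<open>N\<close> so that
  all sums stay finite. A number built from \<open>insert p S\<close> is either built from
  \<open>S\<close> alone or is \<open>p\<close> times a smaller such number, so a new prime costs at
  most the factor 1 / (1 - p^(-s)).\<close>

lemma sum_smooth_le_prod:
  fixes s :: real
  assumes "finite S" "\<And>p. p \<in> S \<Longrightarrow> prime p" "s > 0"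
  shows "(\<Sum>n | n \<in> {1..N} \<and> prime_factors n \<subseteq> S. real n powr - s) \<le> (\<Prod>p\<in>S. 1 / (1 - real p powr - s))"
  using assms(1,2)
proof (induction S rule: finite_induct)
  case empty
  have "n \<le> 1" if "prime_factors n \<subseteq> {}" for n :: nat
    using that by (metis One_nat_def bot.extremum_uniqueI in_prime_factors_iff empty_iff
       prime_factor_nat le_0_eq le_SucE nat_le_linear)
  then have "(\<Sum>n | n \<in> {1..N} \<and> prime_factors n \<subseteq> {}. real n powr - s) \<le> (\<Sum>n\<in>{1}. real n powr - s)"
    by (intro sum_mono2) (auto simp: le_Suc_eq)
  then show ?case by simp
next
  case (insert p S)
  let ?f = "\<lambda>n. real n powr - s"
  let ?T = "\<lambda>S. {n. n \<in> {1..N} \<and> prime_factors n \<subseteq> S}"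
  have p: "prime p" "p > 0" "p > 1" using insert.prems[of p] by (auto simp: prime_gt_0_nat dest: prime_gt_1_nat)
  have lt1: "?f p < 1" using p \<open>s > 0\<close> by (simp add: powr_less_one)
  have "?T (insert p S) \<subseteq> ?T S \<union> (*) p ` ?T (insert p S)"
  proof
    fix n assume n: "n \<in> ?T (insert p S)"
    show "n \<in> ?T S \<union> (*) p ` ?T (insert p S)"
    proof (cases "p dvd n")
      case True
      then obtain m where m: "n = p * m" by auto
      with n p have "m > 0" by (cases m) auto
      then have "m \<le> n" using m p by simp
      moreover have "n \<le> N" using n by simp
      ultimately have "m \<le> N" by linarith
      with m n \<open>m > 0\<close> p have "m \<in> ?T (insert p S)"
        by (auto simp: prime_factors_product prime_prime_factors)
      with m show ?thesis by auto
    next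
      case False
      with n show ?thesis by (auto simp: in_prime_factors_iff)
    qed
  qed
  then have "sum ?f (?T (insert p S)) \<le> sum ?f (?T S \<union> (*) p ` ?T (insert p S))"
    by (intro sum_mono2) auto
  also have "\<dots> \<le> sum ?f (?T S) + sum ?f ((*) p ` ?T (insert p S))"
    by (subst sum_Un) (auto intro: sum_nonneg)
  also have "sum ?f ((*) p ` ?T (insert p S)) = ?f p * sum ?f (?T (insert p S))"
    using p by (subst sum.reindex) (auto simp: inj_on_def sum_distrib_left powr_mult)
  finally have "sum ?f (?T (insert p S)) * (1 - ?f p) \<le> sum ?f (?T S)"
    by (simp add: algebra_simps)
  also have "\<dots> \<le> (\<Prod>p\<in>S. 1 / (1 - ?f p))"
    using insert by auto
  finally show ?case
    using insert.hyps lt1 by (simp add: field_simps)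
qed

lemma sum_inverse_squares_le: "(\<Sum>n=2..N. 1 / (real n)\<^sup>2) \<le> 1"
proof -
  \<comment> \<open>The term -1/N strengthens the claim so that the induction telescopes.\<close>
  have "(\<Sum>n=2..N. 1 / (real n)\<^sup>2) \<le> 1 - 1 / real N" if "N \<ge> 1"
    using that
  proof (induction N rule: dec_induct)
    case (step n)
    have "1 / (real (Suc n))\<^sup>2 \<le> 1 / real n - 1 / real (Suc n)"
    proof -
      have "1 / (real (Suc n))\<^sup>2 \<le> 1 / (real n * real (Suc n))"
        using step by (intro frac_le) (auto simp: power2_eq_square intro!: mult_right_mono)
      also have "\<dots> = 1 / real n - 1 / real (Suc n)"
        using step by (simp add: divide_simps)
      finally show ?thesis .
    qed
    moreover have "(\<Sum>i=2..Suc n. 1 / (real i)\<^sup>2) = (\<Sum>i=2..n. 1 / (real i)\<^sup>2) + 1 / (real (Suc n))\<^sup>2"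
      using step by (simp add: sum.nat_ivl_Suc')
    ultimately show ?case using step by linarith
  qed simp
  then show ?thesis by (cases "N \<ge> 1") (auto intro: order_trans)
qed

text \<open>The right-hand side is the integral of x^(-1-s) from 1 to N+1. The comparison is done
  one step at a time: the increment (x^(-s) - (x+1)^(-s)) / s is at most x^(-1-s).\<close>

lemma sum_powr_ge:
  fixes s :: real
  assumes "s > 0"
  shows "(\<Sum>n=1..N. real n powr - (1 + s)) \<ge> (1 - real (Suc N) powr - s) / s"
proof (induction N)
  case (Suc N)
  define x where "x = real (Suc N)"
  have x: "x > 0" "real (Suc (Suc N)) = x * (1 + 1 / x)"
    by (simp_all add: x_def field_simps)
  then have "1 + 1 / x > 0"
    by (simp add: add_pos_pos)
  have "(1 + 1 / x) powr - s = exp (- s * ln (1 + 1 / x))"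
    using \<open>1 + 1 / x > 0\<close> by (simp add: powr_def)
  moreover have "\<dots> \<ge> 1 - s * ln (1 + 1 / x)"
    using exp_ge_add_one_self[of "- s * ln (1 + 1 / x)"] by simp
  moreover have "ln (1 + 1 / x) \<le> 1 / x"
    using x(1) by (intro ln_add_one_self_le_self) simp
  then have "s * ln (1 + 1 / x) \<le> s * (1 / x)"
    using assms by (intro mult_left_mono) auto
  ultimately have "1 - (1 + 1 / x) powr - s \<le> s / x"
    by simp
  then have "x powr - s * (1 - (1 + 1 / x) powr - s) \<le> x powr - s * (s / x)"
    by (intro mult_left_mono) auto
  also have "\<dots> = s * x powr - (1 + s)"
    using x(1) by (simp add: powr_diff powr_minus powr_add field_simps)
  finally have "(x powr - s - real (Suc (Suc N)) powr - s) / s \<le> x powr - (1 + s)"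
    unfolding x(2) using x(1) assms
    by (simp add: powr_mult add_pos_pos less_imp_le pos_divide_le_eq right_diff_distrib mult.commute)
  then show ?case
    using Suc by (simp add: x_def diff_divide_distrib)
qed simp

text \<open>Turns each Euler factor into an exponential; the product over primes then becomes the
  exponential of the prime sum, up to a bounded sum of squares.\<close>

lemma inverse_one_minus_le_exp:
  fixes x :: real
  assumes "0 \<le> x" "x \<le> 1/2"
  shows "1 / (1 - x) \<le> exp (x + 2 * x\<^sup>2)"
proof -
  have "exp (- x - 2 * x\<^sup>2) \<le> 1 - x"
    using ln_one_minus_pos_lower_bound[OF assms] assms by (simp add: ln_ge_iff)
  moreover have "exp (x + 2 * x\<^sup>2) * exp (- x - 2 * x\<^sup>2) = 1"
    by (simp flip: exp_add)
  ultimately have "1 \<le> exp (x + 2 * x\<^sup>2) * (1 - x)"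
    by (metis exp_ge_zero mult_left_mono)
  then show ?thesis using assms by (simp add: divide_le_eq)
qed

lemma prime_powr_sum_ge:
  fixes s :: real
  assumes "0 < s"
  shows "\<exists>N. ln (1 / s) - 3 \<le> (\<Sum>p | prime p \<and> p \<le> N. real p powr - (1 + s))"
proof -
  \<comment> \<open>This cutoff makes (N+1)^(-s) at most 1/2, so the truncated zeta sum is at least
    1 / (2s).\<close>
  define N where "N = nat \<lceil>2 powr (1 / s)\<rceil>"
  define S where "S = {p. prime p \<and> p \<le> N}"
  let ?f = "\<lambda>p. real p powr - (1 + s)"
  have S: "finite S" "\<And>p. p \<in> S \<Longrightarrow> prime p" "S \<subseteq> {2..N}"
    by (auto simp: S_def prime_ge_2_nat)
  have f: "?f p \<le> 1 / real p" "?f p \<le> 1 / 2" "0 \<le> ?f p" if "p \<in> S" for p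
  proof -
    have "p \<ge> 2" using S(3) that by auto
    have "?f p \<le> real p powr - 1"
      using \<open>p \<ge> 2\<close> assms by (intro powr_mono) auto
    then show "?f p \<le> 1 / real p"
      using \<open>p \<ge> 2\<close> by (simp add: powr_minus_divide)
    also have "\<dots> \<le> 1 / 2" using \<open>p \<ge> 2\<close> by simp
    finally show "?f p \<le> 1 / 2" .
  qed simp
  have "2 powr (1 / s) \<le> real (Suc N)"
    unfolding N_def by linarith
  then have "real (Suc N) powr - s \<le> (2 powr (1 / s)) powr - s"
    using assms by (intro powr_mono2') auto
  also have "\<dots> = 1 / 2"
    using assms by (simp add: powr_powr powr_minus_divide)
  finally have "1 / (2 * s) \<le> (1 - real (Suc N) powr - s) / s"
    using assms by (simp add: field_simps)
  also have "\<dots> \<le> (\<Sum>n=1..N. ?f n)"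
    using assms by (rule sum_powr_ge)
  also have "\<dots> = (\<Sum>n | n \<in> {1..N} \<and> prime_factors n \<subseteq> S. ?f n)"
    by (intro sum.cong) (auto simp: S_def in_prime_factors_iff dest!: dvd_imp_le)
  also have "\<dots> \<le> (\<Prod>p\<in>S. 1 / (1 - ?f p))"
    using S assms by (intro sum_smooth_le_prod) auto
  also have "\<dots> \<le> (\<Prod>p\<in>S. exp (?f p + 2 * (?f p)\<^sup>2))"
    using f by (intro prod_mono conjI inverse_one_minus_le_exp) (auto intro: order_trans[of _ "1/2"])
  also have "\<dots> = exp ((\<Sum>p\<in>S. ?f p) + 2 * (\<Sum>p\<in>S. (?f p)\<^sup>2))"
    by (simp add: S sum.distrib sum_distrib_left flip: exp_sum)
  also have "(\<Sum>p\<in>S. (?f p)\<^sup>2) \<le> (\<Sum>p\<in>S. (1 / real p)\<^sup>2)"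
    using f by (intro sum_mono power_mono)
  also have "\<dots> \<le> (\<Sum>p\<in>{2..N}. (1 / real p)\<^sup>2)"
    using S by (intro sum_mono2) auto
  also have "\<dots> \<le> 1"
    using sum_inverse_squares_le[of N] by (simp add: power_divide)
  finally have "1 / (2 * s) \<le> exp ((\<Sum>p\<in>S. ?f p) + 2)"
    by simp
  then have "ln (1 / (2 * s)) \<le> ln (exp ((\<Sum>p\<in>S. ?f p) + 2))"
    using assms by (intro ln_mono) auto
  then have "ln (1 / (2 * s)) \<le> (\<Sum>p\<in>S. ?f p) + 2"
    by simp
  \<comment> \<open>The constant 3 in the claim is 2 from the squares plus 1 as a bound for
    \<open>ln 2\<close>.\<close>
  moreover have "ln (1 / (2 * s)) = ln (1 / s) - ln 2"
    using assms by (simp add: ln_div ln_mult)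
  moreover have "ln 2 \<le> (1::real)"
    using ln_le_minus_one[of "2::real"] by simp
  ultimately show ?thesis
    unfolding S_def by (intro exI[of _ N]) linarith
qed

text \<open>Discarding the primes up to \<open>y\<close> loses at most 1 for each integer up to
  \<open>y\<close>. With \<open>s = exp (- u)\<close> the bound reads P(u) \<ge> u - (3 +
  y).\<close>

lemma large_prime_powr_sum_ge:
  fixes s :: real
  assumes "0 < s"
  shows "\<exists>N. ln (1 / s) - (3 + real y) \<le> (\<Sum>p | prime p \<and> y < p \<and> p \<le> N. real p powr - (1 + s))"
proof -
  let ?f = "\<lambda>p. real p powr - (1 + s)"
  obtain N where N: "ln (1 / s) - 3 \<le> (\<Sum>p | prime p \<and> p \<le> N. ?f p)"
    using prime_powr_sum_ge[OF assms] by auto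
  have le1: "?f p \<le> 1" if "p \<ge> 1" for p
    using powr_mono[of "- (1 + s)" 0 "real p"] that assms by simp
  have "(\<Sum>p | prime p \<and> p \<le> N. ?f p) \<le> (\<Sum>p\<in>{p. prime p \<and> y < p \<and> p \<le> N} \<union> {1..y}. ?f p)"
    by (intro sum_mono2) (auto simp: Suc_le_eq prime_gt_0_nat)
  also have "\<dots> \<le> (\<Sum>p | prime p \<and> y < p \<and> p \<le> N. ?f p) + (\<Sum>p\<in>{1..y}. ?f p)"
    by (subst sum_Un) (auto intro: sum_nonneg)
  also have "(\<Sum>p\<in>{1..y}. ?f p) \<le> real y"
    using sum_bounded_above[of "{1..y}" ?f 1] le1 by simp
  finally show ?thesis
    using N by (intro exI[of _ N]) linarith
qed

subsection \<open>The weighted sum over almost primes\<close>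

text \<open>Shifting by \<open>c\<close> turns the integrand into a constant multiple of the Erlang
  density, whose total mass is 1.\<close>

lemma nn_integral_exp_atLeast:
  fixes z :: real
  assumes "z > 0"
  shows "(\<integral>\<^sup>+u. ennreal (indicator {c..} u * (exp (- z * u) * (u - c) ^ l / fact l)) \<partial>lborel) =
    ennreal (exp (- z * c) / z ^ Suc l)"
proof -
  have "(\<integral>\<^sup>+u. ennreal (indicator {c..} u * (exp (- z * u) * (u - c) ^ l / fact l)) \<partial>lborel) =
      (\<integral>\<^sup>+u. ennreal (indicator {c..} (c + 1 * u) * (exp (- z * (c + 1 * u)) * (c + 1 * u - c) ^ l / fact l)) \<partial>lborel)"
    by (subst nn_integral_real_affine[where c = 1 and t = c]) auto
  also have "\<dots> = (\<integral>\<^sup>+u. ennreal (exp (- z * c) / z ^ Suc l) * ennreal (erlang_density l z u * u ^ 0) \<partial>lborel)"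
    using assms
    by (intro nn_integral_cong)
       (auto simp: erlang_density_def exp_diff exp_minus field_simps simp flip: ennreal_mult
          split: split_indicator)
  also have "\<dots> = ennreal (exp (- z * c) / z ^ Suc l)"
    using assms by (subst nn_integral_cmult) (auto simp: nn_integral_erlang_ith_moment[of z l 0, simplified])
  finally show ?thesis .
qed

text \<open>Up to the substitution \<open>s = exp (- u)\<close> this is the integral for \<open>\<Gamma>(z) x\<^sup>-\<^sup>z\<close>.\<close>

lemma nn_integral_laplace_le:
  fixes x z :: real
  assumes "x > 0" "z > 0"
  shows "(\<integral>\<^sup>+u. ennreal (exp (- z * u) * exp (- x * exp (- u))) \<partial>lborel) \<le>
    ennreal ((1 / z + exp (z\<^sup>2 / 2)) * x powr - z)"
proof -
  define E where "E = (\<lambda>k v :: real. ennreal (indicator {0..} v * exp (- k * v)))"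
  have [measurable]: "E k \<in> borel_measurable borel" for k
    unfolding E_def by measurable
  have E: "(\<integral>\<^sup>+v. E k v \<partial>lborel) = ennreal (1 / k)" if "k > 0" for k
    using nn_integral_exp_atLeast[OF that, of 0 0] by (simp add: E_def)
  \<comment> \<open>The shift by \<open>ln x\<close> extracts \<open>x powr - z\<close> and leaves
    an integral free of \<open>x\<close>.\<close>
  have "(\<integral>\<^sup>+u. ennreal (exp (- z * u) * exp (- x * exp (- u))) \<partial>lborel) =
      (\<integral>\<^sup>+v. ennreal (exp (- z * (ln x + 1 * v)) * exp (- x * exp (- (ln x + 1 * v)))) \<partial>lborel)"
    by (subst nn_integral_real_affine[where c = 1 and t = "ln x"]) auto
  also have "\<dots> = (\<integral>\<^sup>+v. ennreal (x powr - z) * ennreal (exp (- z * v) * exp (- exp (- v))) \<partial>lborel)"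
    using assms
    by (intro nn_integral_cong)
       (simp add: powr_def divide_inverse algebra_simps exp_minus exp_add exp_diff flip: ennreal_mult)
  also have "\<dots> = ennreal (x powr - z) * (\<integral>\<^sup>+v. ennreal (exp (- z * v) * exp (- exp (- v))) \<partial>lborel)"
    by (intro nn_integral_cmult) auto
  also have "(\<integral>\<^sup>+v. ennreal (exp (- z * v) * exp (- exp (- v))) \<partial>lborel) \<le>
      (\<integral>\<^sup>+v. E z v + ennreal (exp (z\<^sup>2 / 2)) * E 1 (- v) \<partial>lborel)"
  proof (intro nn_integral_mono)
    fix v :: real
    show "ennreal (exp (- z * v) * exp (- exp (- v))) \<le> E z v + ennreal (exp (z\<^sup>2 / 2)) * E 1 (- v)"
    proof (cases "v \<ge> 0")
      case True
      then have "ennreal (exp (- z * v) * exp (- exp (- v))) \<le> E z v"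
        unfolding E_def by (intro ennreal_leI) (simp add: mult_le_cancel_left1)
      then show ?thesis by (simp add: add_increasing2)
    next
      case False
      define t where "t = - v"
      \<comment> \<open>For negative \<open>v\<close> the factor \<open>exp (- z * v)\<close> grows,
        but the double exponential beats it: completing the square bounds
        \<open>z * t - exp t\<close> by a constant minus \<open>t\<close>.\<close>
      have "1 + t + t\<^sup>2 / 2 \<le> exp t"
        using False exp_lower_Taylor_quadratic[of t] by (simp add: t_def)
      moreover have "0 \<le> (z - t)\<^sup>2" by simp
      ultimately have "z * t - exp t \<le> z\<^sup>2 / 2 - t"
        by (simp add: power2_diff)
      then have "exp (z * t - exp t) \<le> exp (z\<^sup>2 / 2 - t)" by simp
      then have "exp (- z * v) * exp (- exp (- v)) \<le> exp (z\<^sup>2 / 2) * exp v"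
        by (simp add: t_def flip: exp_add)
      then show ?thesis
        using False by (simp add: E_def ennreal_leI flip: ennreal_mult)
    qed
  qed
  also have "\<dots> = (\<integral>\<^sup>+v. E z v \<partial>lborel) + (\<integral>\<^sup>+v. ennreal (exp (z\<^sup>2 / 2)) * E 1 (- v) \<partial>lborel)"
    by (intro nn_integral_add) auto
  also have "(\<integral>\<^sup>+v. ennreal (exp (z\<^sup>2 / 2)) * E 1 (- v) \<partial>lborel) =
      ennreal (exp (z\<^sup>2 / 2)) * (\<integral>\<^sup>+v. E 1 (- v) \<partial>lborel)"
    by (intro nn_integral_cmult) auto
  also have "(\<integral>\<^sup>+v. E 1 (- v) \<partial>lborel) = (\<integral>\<^sup>+v. E 1 v \<partial>lborel)"
    by (subst nn_integral_real_affine[where c = "-1" and t = 0]) auto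
  also have "(\<integral>\<^sup>+v. E 1 v \<partial>lborel) = 1"
    using E[of 1] by simp
  also have "(\<integral>\<^sup>+v. E z v \<partial>lborel) = ennreal (1 / z)"
    using assms E by simp
  also have "ennreal (x powr - z) * (ennreal (1 / z) + ennreal (exp (z\<^sup>2 / 2)) * 1) =
      ennreal ((1 / z + exp (z\<^sup>2 / 2)) * x powr - z)"
    using assms by (simp add: mult.commute flip: ennreal_mult ennreal_plus)
  finally show ?thesis
    by (simp add: mult_left_mono)
qed

text \<open>An elementary upper bound for \<Gamma>(z).\<close>

definition laplace_const :: "real \<Rightarrow> real" where
  "laplace_const z = 1 / z + exp (z\<^sup>2 / 2)"

lemma laplace_const_pos: "z > 0 \<Longrightarrow> laplace_const z > 0"
  by (simp add: laplace_const_def add_pos_pos)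

text \<open>The gain is that the bound does not depend on \<open>l\<close>: the Gamma integral
  carries 1 / z^(l+1), which cancels the weight \<open>z ^ l\<close> up to 1/z.\<close>

lemma almost_primes_sum_ge:
  fixes z :: real
  assumes "z > 0" "l > 0"
  shows "\<exists>F. finite F \<and> F \<subseteq> almost_primes {p. prime p \<and> y < p} l \<and>
    exp (- z * (3 + real y)) / (2 * z * laplace_const z) \<le> (\<Sum>m\<in>F. z ^ l / (real m * ln (real m) powr z))"
proof -
  define c where "c = 3 + real y"
  define e where "e = exp (- z * c) / z ^ Suc l"
  define S where "S = (\<lambda>N. {p. prime p \<and> y < p \<and> p \<le> N})"
  define P where "P = (\<lambda>N u. \<Sum>p\<in>S N. real p powr - (1 + exp (- u)))"
  define W where "W = (\<lambda>N u. ennreal (indicator {c..} u * (exp (- z * u) * P N u ^ l / fact l)))"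
  define D where "D = (\<lambda>N. almost_primes (S N) l)"
  let ?G = "laplace_const z"
  have G: "?G > 0" using laplace_const_pos assms by simp
  have e: "e > 0" using assms by (simp add: e_def)
  have S: "finite (S N)" "p \<in> S N \<Longrightarrow> prime p" for N p
    by (auto simp: S_def)
  have P_nonneg: "P N u \<ge> 0" for N u
    by (simp add: P_def sum_nonneg)
  have [measurable]: "P N \<in> borel_measurable borel" for N
    unfolding P_def
    by (intro borel_measurable_sum borel_measurable_continuous_onI continuous_intros)
       (auto simp: S_def prime_gt_0_nat)
  have [measurable]: "W N \<in> borel_measurable borel" for N
    unfolding W_def by measurable
  have "P M u \<le> P N u" if "M \<le> N" for M N u
    unfolding P_def using that by (intro sum_mono2) (auto simp: S_def)
  then have "W M u \<le> W N u" if "M \<le> N" for M N u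
    unfolding W_def using P_nonneg that
    by (intro ennreal_leI mult_left_mono divide_right_mono power_mono) auto
  then have inc: "incseq W"
    by (simp add: incseq_def le_fun_def)
  \<comment> \<open>Here \<open>l > 0\<close> excludes \<open>m = 1\<close>, so that
    \<open>ln m\<close> is positive as the Laplace bound requires.\<close>
  have D: "m > 1" if "m \<in> D N" for m N
    using that assms by (cases "m = 1") (auto simp: D_def almost_primes_def Omega_def)

  \<comment> \<open>The power of the prime sum is replaced by a sum over \<open>D N\<close>. Each
    term is 1/m times a Laplace integrand with \<open>x = ln m\<close>, and is integrated
    separately.\<close>
  have upper: "(\<integral>\<^sup>+u. W N u \<partial>lborel) \<le> ennreal (?G * (\<Sum>m\<in>D N. ln (real m) powr - z / real m))" for N
  proof -
    have "W N u \<le> (\<Sum>m\<in>D N. ennreal (1 / real m) * ennreal (exp (- z * u) * exp (- ln (real m) * exp (- u))))" for u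
    proof -
      have "P N u ^ l \<le> fact l * (\<Sum>m\<in>D N. real m powr - (1 + exp (- u)))"
        unfolding P_def D_def using S by (intro power_sum_le_almost_primes) auto
      then have "exp (- z * u) * P N u ^ l / fact l \<le> exp (- z * u) * (\<Sum>m\<in>D N. real m powr - (1 + exp (- u)))"
        by (simp add: divide_le_eq mult.commute)
      also have "\<dots> = (\<Sum>m\<in>D N. 1 / real m * (exp (- z * u) * exp (- ln (real m) * exp (- u))))"
        unfolding sum_distrib_left
      proof (intro sum.cong refl)
        fix m assume "m \<in> D N"
        then have "real m > 0" using D by force
        then have "real m powr - (1 + exp (- u)) = exp (- ln (real m)) * exp (- ln (real m) * exp (- u))"
          by (simp add: powr_def algebra_simps flip: exp_add)
        also have "exp (- ln (real m)) = 1 / real m"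
          using \<open>real m > 0\<close> by (simp add: exp_minus inverse_eq_divide)
        finally show "exp (- z * u) * real m powr - (1 + exp (- u)) =
            1 / real m * (exp (- z * u) * exp (- ln (real m) * exp (- u)))"
          by simp
      qed
      finally have "W N u \<le> ennreal (\<Sum>m\<in>D N. 1 / real m * (exp (- z * u) * exp (- ln (real m) * exp (- u))))"
        unfolding W_def by (intro ennreal_leI) (auto split: split_indicator intro!: sum_nonneg)
      then show ?thesis
        by (simp add: sum_ennreal flip: ennreal_mult)
    qed
    then have "(\<integral>\<^sup>+u. W N u \<partial>lborel) \<le>
        (\<integral>\<^sup>+u. (\<Sum>m\<in>D N. ennreal (1 / real m) * ennreal (exp (- z * u) * exp (- ln (real m) * exp (- u)))) \<partial>lborel)"
      by (intro nn_integral_mono)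
    also have "\<dots> = (\<Sum>m\<in>D N. ennreal (1 / real m) *
        (\<integral>\<^sup>+u. ennreal (exp (- z * u) * exp (- ln (real m) * exp (- u))) \<partial>lborel))"
      by (simp add: nn_integral_sum nn_integral_cmult)
    also have "\<dots> \<le> (\<Sum>m\<in>D N. ennreal (1 / real m) * ennreal (?G * ln (real m) powr - z))"
      using D assms unfolding laplace_const_def
      by (intro sum_mono mult_left_mono nn_integral_laplace_le ln_gt_zero) auto
    also have "\<dots> = ennreal (?G * (\<Sum>m\<in>D N. ln (real m) powr - z / real m))"
      using G by (simp add: sum_distrib_left sum_ennreal flip: ennreal_mult)
    finally show ?thesis .
  qed

  \<comment> \<open>The cutoff \<open>N\<close> that works depends on \<open>u\<close>, so only the
    supremum over \<open>N\<close> is bounded below pointwise; monotone convergence then moves it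
    outside the integral.\<close>
  have lower: "ennreal (indicator {c..} u * (exp (- z * u) * (u - c) ^ l / fact l)) \<le> (SUP N. W N u)" for u
  proof (cases "u \<ge> c")
    case True
    obtain N where "u - c \<le> P N u"
      using large_prime_powr_sum_ge[of "exp (- u)" y] by (auto simp: P_def S_def c_def ln_div)
    then have "ennreal (indicator {c..} u * (exp (- z * u) * (u - c) ^ l / fact l)) \<le> W N u"
      unfolding W_def using True
      by (intro ennreal_leI mult_left_mono divide_right_mono power_mono) auto
    then show ?thesis by (rule SUP_upper2[OF UNIV_I])
  qed simp

  have "ennreal e = (\<integral>\<^sup>+u. ennreal (indicator {c..} u * (exp (- z * u) * (u - c) ^ l / fact l)) \<partial>lborel)"
    using assms nn_integral_exp_atLeast by (simp add: e_def)
  also have "\<dots> \<le> (\<integral>\<^sup>+u. (SUP N. W N u) \<partial>lborel)"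
    by (intro nn_integral_mono lower)
  also have "\<dots> = (SUP N. \<integral>\<^sup>+u. W N u \<partial>lborel)"
    by (intro nn_integral_monotone_convergence_SUP inc) auto
  finally have "ennreal e \<le> (SUP N. \<integral>\<^sup>+u. W N u \<partial>lborel)" .
  \<comment> \<open>The supremum need not be attained; giving up a factor 2 yields a single
    \<open>N\<close>, hence a finite set.\<close>
  moreover have "ennreal (e / 2) < ennreal e"
    using e by (simp add: ennreal_lessI)
  ultimately obtain N where "ennreal (e / 2) < (\<integral>\<^sup>+u. W N u \<partial>lborel)"
    by (meson less_SUP_iff less_le_trans)
  with upper[of N] have "ennreal (e / 2) \<le> ennreal (?G * (\<Sum>m\<in>D N. ln (real m) powr - z / real m))"
    by simp
  then have "e / 2 \<le> ?G * (\<Sum>m\<in>D N. ln (real m) powr - z / real m)"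
    using G by (simp add: sum_nonneg)
  then have "z ^ l * (e / 2 / ?G) \<le> z ^ l * (\<Sum>m\<in>D N. ln (real m) powr - z / real m)"
    using G assms by (simp add: divide_le_eq mult.commute)
  also have "\<dots> = (\<Sum>m\<in>D N. z ^ l / (real m * ln (real m) powr z))"
    by (simp add: sum_distrib_left powr_minus field_simps)
  also have "z ^ l * (e / 2 / ?G) = exp (- z * (3 + real y)) / (2 * z * ?G)"
    using assms by (simp add: e_def c_def)
  finally show ?thesis
    using finite_almost_primes[OF S(1)]
    by (intro exI[of _ "D N"]) (auto simp: D_def almost_primes_def S_def)
qed

text \<open>About n/\<delta> of the disjoint pieces already give a finite partial sum of at least
  \<open>n\<close>, and for nonnegative terms \<open>infsum\<close> is the supremum of the finite
  partial sums.\<close>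

lemma infsum_ereal_eq_infinity:
  fixes g :: "'a \<Rightarrow> real"
  assumes nonneg: "\<And>a. a \<in> A \<Longrightarrow> g a \<ge> 0"
    and "infinite I" "disjoint_family_on B I" "\<delta> > 0"
    and ex: "\<And>i. i \<in> I \<Longrightarrow> \<exists>F. finite F \<and> F \<subseteq> B i \<and> \<delta> \<le> sum g F"
    and sub: "\<And>i. i \<in> I \<Longrightarrow> B i \<subseteq> A"
  shows "(\<Sum>\<^sub>\<infinity>a\<in>A. ereal (g a)) = \<infinity>"
proof -
  obtain F where F: "\<And>i. i \<in> I \<Longrightarrow> finite (F i) \<and> F i \<subseteq> B i \<and> \<delta> \<le> sum g (F i)"
    using ex by metis
  have "\<exists>G\<in>{G. finite G \<and> G \<subseteq> A}. ereal (real n) \<le> (\<Sum>a\<in>G. ereal (g a))" for n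
  proof -
    obtain J where J: "J \<subseteq> I" "finite J" "card J = nat \<lceil>real n / \<delta>\<rceil>"
      using infinite_arbitrarily_large[OF \<open>infinite I\<close>] by metis
    have "real n / \<delta> \<le> real (card J)"
      using J(3) by linarith
    then have "real n \<le> (\<Sum>i\<in>J. \<delta>)"
      using \<open>\<delta> > 0\<close> by (simp add: field_simps)
    also have "\<dots> \<le> (\<Sum>i\<in>J. sum g (F i))"
      using F J by (intro sum_mono) auto
    also have "\<dots> = sum g (\<Union>i\<in>J. F i)"
    proof (rule sum.UNION_disjoint[symmetric])
      show "\<forall>i\<in>J. \<forall>j\<in>J. i \<noteq> j \<longrightarrow> F i \<inter> F j = {}"
      proof (intro ballI impI)
        fix i j assume ij: "i \<in> J" "j \<in> J" "i \<noteq> j"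
        then have "B i \<inter> B j = {}"
          using assms(3) J(1) by (auto simp: disjoint_family_on_def)
        then show "F i \<inter> F j = {}"
          using F[of i] F[of j] ij J(1) by auto
      qed
    qed (use F J in auto)
    finally show ?thesis
      using F J sub by (intro bexI[of _ "\<Union>i\<in>J. F i"]) (auto, blast)
  qed
  then have "(SUP G\<in>{G. finite G \<and> G \<subseteq> A}. \<Sum>a\<in>G. ereal (g a)) = \<infinity>"
    by (rule SUP_PInfty)
  then show ?thesis
    using nonneg by (subst nonneg_infsum_complete) auto
qed

subsection \<open>Blocks\<close>

definition block :: "nat \<Rightarrow> nat \<Rightarrow> nat set" where
  "block q k = (*) q ` almost_primes (insert 2 {p. prime p \<and> q < p}) k"

text \<open>The multiplicity of 2 recovers \<open>j\<close>. This lets the sum over pairs in a block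
  be read as a sum over distinct elements.\<close>

lemma inj_on_power_two_times_odd:
  "inj_on (\<lambda>(j, m). 2 ^ j * m) {(j, m :: nat). odd m}"
proof (rule inj_onI, clarify)
  fix i j m n :: nat
  assume *: "odd m" "odd n" "2 ^ i * m = 2 ^ j * n"
  have mult: "multiplicity 2 (2 ^ l * r) = l" if "odd r" for l r :: nat
    using multiplicity_prime_elem_times_other[of 2 r "2 ^ l"] that
    by (simp add: mult.commute multiplicity_same_power prime_imp_prime_elem)
  have "i = j"
    using mult[OF *(1), of i] mult[OF *(2), of j] *(3) by simp
  with * show "i = j \<and> m = n" by simp
qed

text \<open>For a = q 2^j m with \<Omega>(m) = k - j, both \<open>q\<close> and 2^j are at most
  \<open>m\<close>, so \<open>ln a\<close> is at most \<open>3 * ln m\<close>; this costs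
  \<open>3 powr z\<close>. The weight z^j against the denominator 2^j leaves
  \<open>(z / 2) ^ j\<close>, and the sum over \<open>m\<close> is bounded below independently of
  \<open>j\<close>.\<close>

lemma block_sum_ge:
  fixes z :: real
  assumes z: "z > 0" and q: "prime q" "q > 2" "q \<le> k div 2"
  shows "\<exists>F. finite F \<and> F \<subseteq> block q k \<and>
    exp (- z * (3 + real q)) / (2 * real q * 3 powr z * laplace_const z) * (\<Sum>j<k div 2. (z / 2) ^ j)
      \<le> (\<Sum>a\<in>F. z ^ Omega a / (real a * ln (real a) powr z))"
proof -
  define J where "J = k div 2"
  define c where "c = exp (- z * (3 + real q)) / (2 * z * laplace_const z)"
  let ?D = "almost_primes {p. prime p \<and> q < p}"
  let ?t = "\<lambda>a. z ^ Omega a / (real a * ln (real a) powr z)"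
  let ?h = "\<lambda>(j, m). q * (2 ^ j * m)"
  have "\<exists>F. finite F \<and> F \<subseteq> ?D (k - j) \<and> c \<le> (\<Sum>m\<in>F. z ^ (k - j) / (real m * ln (real m) powr z))"
    if "j < J" for j
    using almost_primes_sum_ge[OF z, of "k - j" q] that by (simp add: c_def J_def)
  then obtain F where F: "\<And>j. j < J \<Longrightarrow> finite (F j)" "\<And>j. j < J \<Longrightarrow> F j \<subseteq> ?D (k - j)"
      "\<And>j. j < J \<Longrightarrow> c \<le> (\<Sum>m\<in>F j. z ^ (k - j) / (real m * ln (real m) powr z))"
    by metis
  have odd: "odd m" if "m \<in> ?D l" for m l
  proof
    assume "even m"
    with that have "2 \<in> prime_factors m"
      by (auto simp: almost_primes_def in_prime_factors_iff)
    with that show False using q(2) by (auto simp: almost_primes_def)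
  qed
  have "Sigma {..<J} F \<subseteq> {(j, m). odd m}"
    using F(2) odd by blast
  then have "inj_on ((*) q \<circ> (\<lambda>(j, m). 2 ^ j * m)) (Sigma {..<J} F)"
    using q(2) by (intro comp_inj_on inj_on_subset[OF inj_on_power_two_times_odd]) (auto simp: inj_on_def)
  then have inj: "inj_on ?h (Sigma {..<J} F)"
    by (simp add: comp_def case_prod_unfold)

  have termwise: "z / (q * 3 powr z) * ((z / 2) ^ j * (z ^ (k - j) / (real m * ln (real m) powr z))) \<le> ?t (?h (j, m))"
    if j: "j < J" and m: "m \<in> F j" for j m
  proof -
    have m': "m > 0" "Omega m = k - j"
      using F(2)[OF j] m by (auto simp: almost_primes_def)
    have "j \<le> k" "J \<le> k - j"
      using j by (auto simp: J_def)
    \<comment> \<open>As \<open>j\<close> stays below \<open>k div 2\<close>, \<open>m\<close> keeps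
      at least \<open>J\<close> prime factors, so \<open>m\<close> is at least \<open>2 ^ J\<close>,
      which dominates both \<open>q\<close> and \<open>2 ^ j\<close>.\<close>
    have "(2::nat) ^ J \<le> 2 ^ (k - j)"
      using \<open>J \<le> k - j\<close> by (intro power_increasing) auto
    also have "\<dots> \<le> m"
      using Omega_bounds(1)[OF m'(1)] m'(2) by simp
    finally have "2 ^ J \<le> m" .
    moreover have "q \<le> 2 ^ J"
      using q(3) less_exp[of J] unfolding J_def by linarith
    moreover have "(2::nat) ^ j \<le> 2 ^ J"
      using j by (intro power_increasing) auto
    ultimately have le: "q \<le> m" "2 ^ j \<le> m" by linarith+
    have "m > 1" using le q by simp
    define a where "a = q * (2 ^ j * m)"
    have Om: "Omega a = Suc k"
      unfolding a_def using m' q \<open>j \<le> k\<close> by (simp add: Omega_mult Omega_prime Omega_power)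
    have "a \<le> m * (m * m)"
      unfolding a_def using le by (intro mult_mono) auto
    then have "real a \<le> real (m * (m * m))"
      by (rule of_nat_mono)
    then have le3: "real a \<le> real m ^ 3"
      by (simp add: power3_eq_cube)
    have "1 * (1 * m) \<le> a"
      unfolding a_def using q(2) by (intro mult_mono) auto
    then have "a > 1" using \<open>m > 1\<close> by linarith
    have "ln (real a) \<le> ln (real m ^ 3)"
      using le3 \<open>a > 1\<close> by (intro ln_mono) auto
    then have "ln (real a) \<le> 3 * ln (real m)"
      using \<open>m > 1\<close> by (simp add: ln_realpow)
    then have "ln (real a) powr z \<le> (3 * ln (real m)) powr z"
      using z \<open>a > 1\<close> by (intro powr_mono2) auto
    also have "\<dots> = 3 powr z * ln (real m) powr z"
      by (simp add: powr_mult)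
    finally have "z ^ Suc k / (real a * (3 powr z * ln (real m) powr z)) \<le> ?t a"
      unfolding Om using z \<open>a > 1\<close> \<open>m > 1\<close>
      by (intro divide_left_mono mult_left_mono mult_pos_pos) auto
    moreover have "z ^ Suc k = z * (z ^ j * z ^ (k - j))"
      using \<open>j \<le> k\<close> by (simp flip: power_add)
    ultimately have "z * (z ^ j * z ^ (k - j)) / (real a * (3 powr z * ln (real m) powr z)) \<le> ?t a"
      by metis
    moreover have "z * (z ^ j * z ^ (k - j)) / (real a * (3 powr z * ln (real m) powr z)) =
        z / (q * 3 powr z) * ((z / 2) ^ j * (z ^ (k - j) / (real m * ln (real m) powr z)))"
      by (simp add: a_def power_divide mult_ac)
    ultimately show ?thesis
      unfolding a_def case_prod_conv by linarith
  qed

  have "exp (- z * (3 + real q)) / (2 * real q * 3 powr z * laplace_const z) * (\<Sum>j<J. (z / 2) ^ j) =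
      (\<Sum>j<J. z / (q * 3 powr z) * ((z / 2) ^ j * c))"
  proof -
    \<comment> \<open>The weight \<open>z\<close> of the extra prime \<open>q\<close> cancels the
      \<open>z\<close> in the denominator of \<open>c\<close>.\<close>
    have "exp (- z * (3 + real q)) / (2 * real q * 3 powr z * laplace_const z) = z / (q * 3 powr z) * c"
      using z by (simp add: c_def)
    then show ?thesis
      unfolding sum_distrib_left by (simp add: mult_ac)
  qed
  also have "\<dots> \<le> (\<Sum>j<J. z / (q * 3 powr z) * ((z / 2) ^ j *
      (\<Sum>m\<in>F j. z ^ (k - j) / (real m * ln (real m) powr z))))"
    using z F(3) by (intro sum_mono mult_left_mono) auto
  also have "\<dots> = (\<Sum>j<J. \<Sum>m\<in>F j. z / (q * 3 powr z) * ((z / 2) ^ j *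
      (z ^ (k - j) / (real m * ln (real m) powr z))))"
    by (simp add: sum_distrib_left)
  also have "\<dots> \<le> (\<Sum>j<J. \<Sum>m\<in>F j. ?t (?h (j, m)))"
    by (intro sum_mono termwise) auto
  also have "\<dots> = (\<Sum>x\<in>Sigma {..<J} F. ?t (?h x))"
    using F(1) by (subst sum.Sigma) (auto simp: case_prod_unfold)
  also have "\<dots> = (\<Sum>a\<in>?h ` Sigma {..<J} F. ?t a)"
    by (rule sum.reindex[OF inj, unfolded comp_def, symmetric])
  finally have "exp (- z * (3 + real q)) / (2 * real q * 3 powr z * laplace_const z) * (\<Sum>j<J. (z / 2) ^ j)
      \<le> (\<Sum>a\<in>?h ` Sigma {..<J} F. ?t a)" .
  moreover have "?h ` Sigma {..<J} F \<subseteq> block q k"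
  proof
    fix x assume "x \<in> ?h ` Sigma {..<J} F"
    then obtain j m where j: "j < J" and m: "m \<in> F j" and x: "x = q * (2 ^ j * m)"
      by auto
    then have m': "m > 0" "Omega m = k - j" "prime_factors m \<subseteq> {p. prime p \<and> q < p}"
      using F(2)[of j] by (auto simp: almost_primes_def)
    moreover have "j \<le> k" using j by (simp add: J_def)
    moreover have "prime_factors (2 ^ j :: nat) \<subseteq> {2}"
      by (auto simp: prime_factorization_prime_power split: if_splits)
    ultimately show "x \<in> block q k"
      unfolding block_def x
      by (intro imageI) (auto simp: almost_primes_def Omega_mult Omega_power Omega_prime prime_factors_product)
  qed
  ultimately show ?thesis
    using F(1) unfolding J_def by (intro exI[of _ "?h ` Sigma {..<J} F"]) (auto simp: J_def intro!: finite_imageI finite_SigmaI)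
qed

section \<open>Primitivity of the union of the blocks\<close>

lemma block_properties:
  assumes "prime q" "a \<in> block q k"
  shows "a > 0" "Omega a = Suc k" "q dvd a"
    and "prime p \<Longrightarrow> p dvd a \<Longrightarrow> p \<noteq> 2 \<Longrightarrow> p \<ge> q"
proof -
  obtain m where m: "a = q * m" "m > 0" "Omega m = k" "prime_factors m \<subseteq> insert 2 {p. prime p \<and> q < p}"
    using assms(2) by (auto simp: block_def almost_primes_def)
  have "q > 0" using assms(1) by (simp add: prime_gt_0_nat)
  with m assms(1) show "a > 0" "Omega a = Suc k" "q dvd a"
    by (simp_all add: Omega_mult Omega_prime)
  show "p \<ge> q" if p: "prime p" "p dvd a" "p \<noteq> 2"
  proof (cases "p dvd q")
    case True
    then show ?thesis using p assms(1) primes_dvd_imp_eq by auto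
  next
    case False
    then have "p dvd m" using p m(1) by (simp add: prime_dvd_mult_iff)
    then have "p \<in> prime_factors m" using p m(2) by (simp add: in_prime_factors_iff)
    then show ?thesis using p m(4) by auto
  qed
qed

text \<open>For \<open>q < r\<close> no element of the block of \<open>r\<close> is divisible by \<open>q\<close>; for \<open>q > r\<close> it has
  fewer prime factors.\<close>

lemma primitive_set_blocks:
  assumes "strict_mono k"
  shows "primitive_set (\<Union>q\<in>{q. prime q \<and> q > 2}. block q (k q))"
  unfolding primitive_set_def
proof (intro ballI impI)
  fix a b
  assume "a \<in> (\<Union>q\<in>{q. prime q \<and> q > 2}. block q (k q))" "b \<in> (\<Union>q\<in>{q. prime q \<and> q > 2}. block q (k q))"
    and "a dvd b"
  then obtain q r where q: "prime q" "q > 2" "a \<in> block q (k q)" and r: "prime r" "r > 2" "b \<in> block r (k r)"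
    by auto
  note a = block_properties[OF q(1,3)] and b = block_properties[OF r(1,3)]
  obtain c where c: "b = a * c" using \<open>a dvd b\<close> by auto
  then have "c > 0" using b(1) by (cases c) auto
  then have Om: "Omega b = Omega a + Omega c"
    using c a(1) by (simp add: Omega_mult)
  \<comment> \<open>\<open>q\<close> is an odd prime dividing \<open>b\<close>, and the odd prime
    divisors of \<open>b\<close> are at least \<open>r\<close>.\<close>
  have "q \<ge> r"
    using b(4)[OF q(1)] a(3) \<open>a dvd b\<close> q(2) dvd_trans by blast
  moreover have "k q \<le> k r"
    using Om a(2) b(2) by simp
  ultimately have "q = r"
    using assms by (simp add: strict_mono_less_eq)
  then have "Omega c = 0"
    using Om a(2) b(2) by simp
  then have "c = 1"
    using \<open>c > 0\<close> prod_mset_prime_factorization_nat[of c] by (simp add: Omega_def)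
  then show "a = b" using c by simp
qed

section \<open>Choice of the growth of \<open>k\<close>, and divergence\<close>

lemma strict_mono_above:
  fixes B :: "nat \<Rightarrow> nat"
  obtains k where "strict_mono k" "\<And>n. B n \<le> k n"
proof
  \<comment> \<open>\<open>Suc\<close> makes every increment positive, and the last summand alone
    exceeds \<open>B n\<close>.\<close>
  show "strict_mono (\<lambda>n. \<Sum>i\<le>n. Suc (B i))"
    by (simp add: strict_mono_Suc_iff)
  show "B n \<le> (\<Sum>i\<le>n. Suc (B i))" for n
    using member_le_sum[of n "{..n}" "\<lambda>i. Suc (B i)"] by simp
qed

theorem theorem5:
  fixes \<psi> :: "nat \<Rightarrow> real"
  assumes "\<forall>M::real. \<exists>K::nat. \<forall>n. Omega n \<ge> K \<longrightarrow> \<psi> n > M"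
  shows "\<exists>A::nat set. A \<subseteq> {2..} \<and> primitive_set A \<and>
    (\<forall>z::real. 0 < z \<and> z < 2 \<longrightarrow>
      (\<Sum>\<^sub>\<infinity>a\<in>A. ereal (\<psi> a * z ^ Omega a / (real a * ln (real a) powr z))) = \<infinity>) \<and>
    (\<forall>z::real. z \<ge> 2 \<longrightarrow> f_sum z A = \<infinity>)"
proof -
  \<comment> \<open>\<open>W q\<close> outweighs the loss exp(-z (3 + q)) / q in the block bound for
    all z \<le> q at once, so one set serves every \<open>z\<close>.\<close>
  define W where "W = (\<lambda>q. real q * exp (real q * (3 + real q)))"
  have W_ge: "real q \<le> W q" for q
    by (simp add: W_def mult_le_cancel_left1)
  have W_nonneg: "0 \<le> W q" for q
    by (simp add: W_def)
  have "\<forall>q. \<exists>K. \<forall>n. Omega n \<ge> K \<longrightarrow> \<psi> n > W q"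
    using assms by blast
  then obtain K where K: "\<And>q n. Omega n \<ge> K q \<Longrightarrow> \<psi> n > W q"
    by metis
  \<comment> \<open>The bound \<open>K q\<close> forces \<psi> above \<open>W q\<close> on the
    block; the other makes \<open>k q div 2\<close> at least \<open>W q\<close>, for the case z
    \<ge> 2.\<close>
  obtain k where k: "strict_mono k" "\<And>q. max (K q) (2 * nat \<lceil>W q\<rceil>) \<le> k q"
    using strict_mono_above[of "\<lambda>q. max (K q) (2 * nat \<lceil>W q\<rceil>)"] by blast
  have k_half: "W q \<le> real (k q div 2)" "q \<le> k q div 2" for q
  proof -
    have "2 * nat \<lceil>W q\<rceil> \<le> k q"
      by (rule order_trans[OF max.cobounded2 k(2)])
    then have "nat \<lceil>W q\<rceil> \<le> k q div 2" by linarith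
    then show "W q \<le> real (k q div 2)"
      using real_nat_ceiling_ge[of "W q"] by (meson of_nat_mono order_trans)
    with W_ge[of q] show "q \<le> k q div 2" by linarith
  qed
  define A where "A = (\<Union>q\<in>{q. prime q \<and> q > 2}. block q (k q))"
  have \<psi>: "\<psi> a \<ge> W q" if "prime q" "a \<in> block q (k q)" for q a
    using K[of q a] block_properties(2)[OF that] order_trans[OF max.cobounded1 k(2), of q] by simp
  \<comment> \<open>\<psi> may be negative elsewhere; nonnegativity on \<open>A\<close> ensures that
    the unordered sum exists.\<close>
  have \<psi>_nonneg: "\<psi> a \<ge> 0" if "a \<in> A" for a
    using that by (auto simp: A_def intro: order_trans[OF W_nonneg \<psi>])

  \<comment> \<open>Common to both claims: \<open>w\<close> is \<psi> with \<open>v = W\<close> for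
    z < 2, and both are 1 for z \<ge> 2. In each case \<open>v q\<close> times the geometric sum
    reaches \<open>W q\<close>.\<close>
  have diverges: "(\<Sum>\<^sub>\<infinity>a\<in>A. ereal (w a * z ^ Omega a / (real a * ln (real a) powr z))) = \<infinity>"
    if z: "z > 0" and w: "\<And>a. a \<in> A \<Longrightarrow> w a \<ge> 0"
      and v: "\<And>q a. prime q \<Longrightarrow> q > 2 \<Longrightarrow> a \<in> block q (k q) \<Longrightarrow> v q \<le> w a" "\<And>q. v q \<ge> 0"
      and vW: "\<And>q. q > 2 \<Longrightarrow> W q \<le> v q * (\<Sum>j<k q div 2. (z / 2) ^ j)"
    for z :: real and w :: "nat \<Rightarrow> real" and v :: "nat \<Rightarrow> real"
  proof (rule infsum_ereal_eq_infinity)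
    let ?t = "\<lambda>a. z ^ Omega a / (real a * ln (real a) powr z)"
    \<comment> \<open>Only blocks with q > z are used; each contributes at least
      \<open>1 / d\<close>, which depends on \<open>z\<close> alone.\<close>
    let ?I = "{q. prime q \<and> max 2 (nat \<lceil>z\<rceil>) < q}"
    define d where "d = 2 * 3 powr z * laplace_const z"
    have d: "d > 0"
      using laplace_const_pos[OF z] by (simp add: d_def)
    show "w a * z ^ Omega a / (real a * ln (real a) powr z) \<ge> 0" if "a \<in> A" for a
      using w[OF that] z by simp
    show "infinite ?I"
      unfolding infinite_nat_iff_unbounded
    proof
      fix n
      obtain p where "prime p" "max n (max 2 (nat \<lceil>z\<rceil>)) < p"
        using bigger_prime by blast
      then show "\<exists>p>n. p \<in> ?I" by auto
    qed
    show "disjoint_family_on (\<lambda>q. block q (k q)) ?I"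
      unfolding disjoint_family_on_def
    proof (intro ballI impI)
      fix q r assume qr: "q \<in> ?I" "r \<in> ?I" "q \<noteq> r"
      \<comment> \<open>All elements of one block have the same number of prime factors, and this
        number differs between blocks.\<close>
      then have "k q \<noteq> k r" using k(1) by (simp add: strict_mono_eq)
      then show "block q (k q) \<inter> block r (k r) = {}"
        using block_properties(2) qr by (metis (mono_tags, lifting) disjoint_iff mem_Collect_eq nat.inject)
    qed
    show "1 / d > 0" using d by simp
    show "block q (k q) \<subseteq> A" if "q \<in> ?I" for q
      using that by (auto simp: A_def)
    show "\<exists>F. finite F \<and> F \<subseteq> block q (k q) \<and>
        1 / d \<le> (\<Sum>a\<in>F. w a * z ^ Omega a / (real a * ln (real a) powr z))" if "q \<in> ?I" for q
    proof -
      from that have q: "prime q" "q > 2" "nat \<lceil>z\<rceil> < q" by auto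
      from q(3) have "z \<le> real q"
        by linarith
      let ?s = "\<Sum>j<k q div 2. (z / 2) ^ j"
      let ?e = "exp (- z * (3 + real q)) / (2 * real q * 3 powr z * laplace_const z)"
      from block_sum_ge[OF z q(1,2) k_half(2)]
      obtain F where F: "finite F" "F \<subseteq> block q (k q)" "?e * ?s \<le> (\<Sum>a\<in>F. ?t a)"
        by (elim exE conjE)
      have "1 \<le> exp ((real q - z) * (3 + real q))"
        using \<open>z \<le> real q\<close> by simp
      also have "(real q - z) * (3 + real q) = real q * (3 + real q) + - z * (3 + real q)"
        by (simp add: left_diff_distrib)
      also have "exp \<dots> = W q * exp (- z * (3 + real q)) / real q"
        unfolding exp_add using q(2) by (simp add: W_def)
      finally have "1 / d \<le> W q * exp (- z * (3 + real q)) / real q / d"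
        using d by (intro divide_right_mono) auto
      also have "\<dots> = ?e * W q"
        by (simp add: d_def mult_ac)
      also have "\<dots> \<le> ?e * (v q * ?s)"
        using vW[OF q(2)] laplace_const_pos[OF z] by (intro mult_left_mono) auto
      also have "\<dots> = v q * (?e * ?s)"
        by simp
      also have "\<dots> \<le> v q * (\<Sum>a\<in>F. ?t a)"
        using F v(2) by (intro mult_left_mono) auto
      also have "\<dots> \<le> (\<Sum>a\<in>F. w a * ?t a)"
        unfolding sum_distrib_left using F v(1)[OF q(1,2)] z
        by (intro sum_mono mult_right_mono) auto
      finally show ?thesis using F by auto
    qed
  qed

  show ?thesis
  proof (intro exI[of _ A] conjI allI impI)
    show "A \<subseteq> {2..}"
    proof
      fix a assume "a \<in> A"
      then obtain q where q: "prime q" "q > 2" "a \<in> block q (k q)" by (auto simp: A_def)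
      then show "a \<in> {2..}"
        using block_properties(1,3)[OF q(1,3)] dvd_imp_le[of q a] by simp
    qed
    show "primitive_set A"
      unfolding A_def using k(1) by (rule primitive_set_blocks)
    show "(\<Sum>\<^sub>\<infinity>a\<in>A. ereal (\<psi> a * z ^ Omega a / (real a * ln (real a) powr z))) = \<infinity>"
      if "0 < z \<and> z < 2" for z :: real
    proof (rule diverges[where v = W])
      fix q :: nat assume "q > 2"
      \<comment> \<open>For z < 2 the term \<open>j = 0\<close> suffices, since \<psi> already
        supplies \<open>W q\<close>.\<close>
      have "(\<Sum>j\<in>{0}. (z / 2) ^ j) \<le> (\<Sum>j<k q div 2. (z / 2) ^ j)"
        using that k_half(2)[of q] \<open>q > 2\<close> by (intro sum_mono2) auto
      then show "W q \<le> W q * (\<Sum>j<k q div 2. (z / 2) ^ j)"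
        using W_nonneg[of q] by (simp add: mult_le_cancel_left1)
    qed (use that \<psi> \<psi>_nonneg W_nonneg in auto)
    show "f_sum z A = \<infinity>" if "z \<ge> 2" for z :: real
    proof -
      have "(\<Sum>\<^sub>\<infinity>a\<in>A. ereal (1 * z ^ Omega a / (real a * ln (real a) powr z))) = \<infinity>"
      proof (rule diverges[where v = "\<lambda>_. 1"])
        fix q :: nat
        \<comment> \<open>For z \<ge> 2 every term is at least 1, so the number of terms supplies
          \<open>W q\<close>.\<close>
        have "(\<Sum>j<k q div 2. 1) \<le> (\<Sum>j<k q div 2. (z / 2) ^ j)"
          using that by (intro sum_mono one_le_power) auto
        then show "W q \<le> 1 * (\<Sum>j<k q div 2. (z / 2) ^ j)"
          using k_half(1)[of q] by simp
      qed (use that in auto)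
      then show ?thesis by (simp add: f_sum_def)
    qed
  qed
qed

end
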